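(* Assume that $\lambda>\max\{0,2\sigma\}$, let $x\in\mathbb{R}^d$ and let $U=\{u\in\mathbb{R}^m:-\rho_i\le u_i\le\rho_i,\ i=1,\dots,m\}$ with $\rho_i>0$. Let $\bar u\in U^\Delta$ satisfy, for any $k\in\mathbb{N}$ and $t\in I_k$, $$\bar u(t)\in\operatorname*{arg\,min}_{u=(u_1,\dots,u_m)\in U}\left\{\int_{I_k}\langle\bar\varphi(s),Bu\rangle\,ds+\gamma b_k\|u\|_p^q\right\},$$ where $\bar y$ is the trajectory corresponding to $\bar u$ and $\bar\varphi$ is the adjoint state associated to $(\bar y,\bar u)$. Set $$\varphi_k=(\varphi_{k,1},\dots,\varphi_{k,m})=\int_{I_k}B^T\bar\varphi(t)\,dt,\qquad\gamma_k=\gamma b_k,$$ and for each $k\in\mathbb{N}$ define $$I_k^-=\{i: |\varphi_{k,i}|\rho_i^{1-q}<\gamma_k\},\quad I_k^0=\{i: |\varphi_{k,i}|\rho_i^{1-q}=\gamma_k\},\quad I_k^+=\{i: |\varphi_{k,i}|\rho_i^{1-q}>\gamma_k\},$$ with $i$ ranging over $\{1,\dots,m\}$. Then the following hold: (i) For $k\in\mathbb{N}$, $t\in I_k$ and $i\in I_k^-$: $\bar u_i(t)=0$. (ii) For $k\in\mathbb{N}$, $t\in I_k$ and $i\in I_k^0$: - if $I_k^+\ne\emptyset$, then $\bar u_i(t)=0$; - if $I_k^+=\emptyset$ and $q\in[p,1)$, then $\bar u_i(t)\in\{0,-\rho_i\operatorname{sgn}(\varphi_{k,i})\}$, and $\bar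 u_i(t)\bar u_j(t)=0$ for all $i,j\in I_k^0$, $i\ne j$; - if $I_k^+=\emptyset$ and $q=1$, then $\bar u_i(t)$ lies in the closed interval with endpoints $0$ and $-\rho_i\operatorname{sgn}(\varphi_{k,i})$, and $\bar u_i(t)\bar u_j(t)=0$ for all $i,j\in I_k^0$, $i\ne j$. (iii) For $k\in\mathbb{N}$, $t\in I_k$ and $i\in I_k^+$: $\bar u_i(t)\in\{0,-\rho_i\operatorname{sgn}(\varphi_{k,i})\}$, and $\max_{i\in I_k^+}|\bar u_i(t)|\ne0$.
   Context: Parameters: $0<p<1$, $q\in[p,1]$, $\gamma>0$, $y_d\in\mathbb{R}^d$; $\mathbb{N}=\{0,1,2,\dots\}$; $\|u\|_p=(\sum_{i=1}^m|u_i|^p)^{1/p}$ for $u\in\mathbb{R}^m$. Let $A\in\mathbb{R}^{d\times d}$, $B\in\mathbb{R}^{d\times m}$; $\sigma=\sup\{\operatorname{Re}\mu:\mu\text{ an eigenvalue of }A\}$. The trajectory corresponding to a control $u$ is the solution of $\dot y(t)=Ay(t)+Bu(t)$, $y(0)=x$. Temporal grid: $0=t_0<t_1<\cdots<t_k<t_{k+1}<\cdots$ with $t_k\to\infty$, $I_k=[t_k,t_{k+1})$, $b_k=\int_{I_k}e^{-\lambda t}dt$. (The time intervals $I_k$ are distinct from the index sets $I_k^-,I_k^0,I_k^+$.) $U^\Delta$ is the set of $u\in L^\infty(0,\infty;U)$ that are constant on each $I_k$. Adjoint state: $L^2_\lambda(0,\infty;\mathbb{R}^d)$ denotes the space of measurable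 $z:(0,\infty)\to\mathbb{R}^d$ with $\int_0^\infty e^{\lambda t}\|z(t)\|_2^2\,dt<\infty$. For $(y,u)$ satisfying the state equation with $u\in U^\Delta$, the adjoint state $\varphi$ associated to $(y,u)$ is the unique function with $\varphi,\dot\varphi\in L^2_\lambda(0,\infty;\mathbb{R}^d)$ solving $-\dot\varphi(t)=A^T\varphi(t)+e^{-\lambda t}(y(t)-y_d)$ for $t>0$, $\lim_{t\to\infty}\varphi(t)=0$.
   Formalization: In (ii), the vanishing of u_i on I_k^0 when I_k^+ is nonempty, and the product claim u_i u_j = 0 for q<1, are asserted only for p<q; both fail for q=p, where the penalty is separable. All other claims are kept for every q in [p,1]. *)

theory Defs
  imports "HOL-Analysis.Analysis"
begin

text \<open>The eigenvalues of a real matrix are its complex eigenvalues.\<close>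

definition eigenvalue :: "real^'d^'d \<Rightarrow> complex \<Rightarrow> bool" where
  "eigenvalue A \<mu> \<longleftrightarrow>
     (\<exists>v :: complex^'d. v \<noteq> 0 \<and> map_matrix complex_of_real A *v v = \<mu> *s v)"

definition spectral_abscissa :: "real^'d^'d \<Rightarrow> real" where
  "spectral_abscissa A = Sup {Re \<mu> | \<mu>. eigenvalue A \<mu>}"

definition lp_norm :: "real \<Rightarrow> real^'m \<Rightarrow> real" where
  "lp_norm p u = (\<Sum>i\<in>UNIV. \<bar>u $ i\<bar> powr p) powr (1 / p)"

definition control_box :: "real^'m \<Rightarrow> (real^'m) set" where
  "control_box \<rho> = {u. \<forall>i. - \<rho> $ i \<le> u $ i \<and> u $ i \<le> \<rho> $ i}"

definition temporal_grid :: "(nat \<Rightarrow> real) \<Rightarrow> bool" where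
  "temporal_grid \<tau> \<longleftrightarrow> \<tau> 0 = 0 \<and> strict_mono \<tau> \<and> filterlim \<tau> at_top sequentially"

definition grid_interval :: "(nat \<Rightarrow> real) \<Rightarrow> nat \<Rightarrow> real set" where
  "grid_interval \<tau> k = {\<tau> k ..< \<tau> (Suc k)}"

definition grid_weight :: "real \<Rightarrow> (nat \<Rightarrow> real) \<Rightarrow> nat \<Rightarrow> real" where
  "grid_weight lam \<tau> k = integral (grid_interval \<tau> k) (\<lambda>t. exp (- lam * t))"

definition Linfty_controls :: "(real^'m) set \<Rightarrow> (real \<Rightarrow> real^'m) set" where
  "Linfty_controls U = {u. u \<in> borel_measurable (lebesgue_on {0<..}) \<and>
     (\<exists>C. AE t in lebesgue_on {0<..}. norm (u t) \<le> C) \<and>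
     (AE t in lebesgue_on {0<..}. u t \<in> U)}"

text \<open>Elements are the representatives that are constant everywhere (not just almost
  everywhere) on each grid interval.\<close>

definition grid_controls ::
    "(nat \<Rightarrow> real) \<Rightarrow> (real^'m) set \<Rightarrow> (real \<Rightarrow> real^'m) set" where
  "grid_controls \<tau> U =
     {u \<in> Linfty_controls U. \<forall>k. \<exists>c. \<forall>t \<in> grid_interval \<tau> k. u t = c}"

text \<open>Since the control is only \<open>L\<^sup>\<infinity>\<close>, the state equation \<open>y' = A y + B u\<close>, \<open>y(0) = x\<close>
  is understood in the sense of Caratheodory, i.e. in integrated form.\<close>

definition trajectory ::
    "real^'d^'d \<Rightarrow> real^'m^'d \<Rightarrow> real^'d \<Rightarrow> (real \<Rightarrow> real^'m) \<Rightarrow> (real \<Rightarrow> real^'d) \<Rightarrow> bool" where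
  "trajectory A B x u y \<longleftrightarrow> continuous_on {0..} y \<and>
     (\<forall>t\<ge>0. ((\<lambda>s. A *v y s + B *v u s) has_integral (y t - x)) {0..t})"

definition L2_weighted :: "real \<Rightarrow> (real \<Rightarrow> real^'d) set" where
  "L2_weighted lam = {z. z \<in> borel_measurable (lebesgue_on {0<..}) \<and>
     integrable (lebesgue_on {0<..}) (\<lambda>t. exp (lam * t) * (norm (z t))\<^sup>2)}"

text \<open>The right-hand side of the adjoint equation is continuous for continuous \<open>y\<close>, so its
  solutions are classical. The function is determined only on the open half-line.\<close>

definition adjoint_state ::
    "real^'d^'d \<Rightarrow> real \<Rightarrow> real^'d \<Rightarrow> (real \<Rightarrow> real^'d) \<Rightarrow> (real \<Rightarrow> real^'d) \<Rightarrow> bool" where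
  "adjoint_state A lam y\<^sub>d y \<phi> \<longleftrightarrow> \<phi> \<in> L2_weighted lam \<and>
     (\<exists>\<phi>'. \<phi>' \<in> L2_weighted lam \<and>
        (\<forall>t>0. (\<phi> has_vector_derivative \<phi>' t) (at t) \<and>
          - \<phi>' t = transpose A *v \<phi> t + exp (- lam * t) *\<^sub>R (y t - y\<^sub>d))) \<and>
     (\<phi> \<longlongrightarrow> 0) at_top"

definition adjoint_moment ::
    "real^'m^'d \<Rightarrow> (nat \<Rightarrow> real) \<Rightarrow> (real \<Rightarrow> real^'d) \<Rightarrow> nat \<Rightarrow> real^'m" where
  "adjoint_moment B \<tau> \<phi> k = integral (grid_interval \<tau> k) (\<lambda>t. transpose B *v \<phi> t)"

definition idx_minus :: "real^'m \<Rightarrow> real \<Rightarrow> real^'m \<Rightarrow> real \<Rightarrow> 'm set" where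
  "idx_minus \<rho> q f g = {i. \<bar>f $ i\<bar> * \<rho> $ i powr (1 - q) < g}"

definition idx_zero :: "real^'m \<Rightarrow> real \<Rightarrow> real^'m \<Rightarrow> real \<Rightarrow> 'm set" where
  "idx_zero \<rho> q f g = {i. \<bar>f $ i\<bar> * \<rho> $ i powr (1 - q) = g}"

definition idx_plus :: "real^'m \<Rightarrow> real \<Rightarrow> real^'m \<Rightarrow> real \<Rightarrow> 'm set" where
  "idx_plus \<rho> q f g = {i. \<bar>f $ i\<bar> * \<rho> $ i powr (1 - q) > g}"

end

theory Submission
  imports Defs
begin

text \<open>On each grid interval the control minimizes the finite-dimensional function
  \<open>v \<mapsto> f \<bullet> v + g * (\<Sum>j. \<bar>v\<^sub>j\<bar>\<^sup>p)\<^bsup>q/p\<^esup>\<close> over the box, where \<open>f = \<phi>\<^sub>k\<close> and \<open>g = \<gamma>\<^sub>k > 0\<close>.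
  Since \<open>q/p \<ge> 1\<close>, the penalty is superadditive in the coordinates, strictly so if \<open>p < q\<close>;
  comparing a minimizer with the vector in which one coordinate is set to zero then gives the sign
  of each nonzero coordinate and the vanishing statements. In a single coordinate the function is
  strictly concave on either side of zero, except when \<open>q = 1\<close> and all other coordinates vanish,
  where it is linear; this forces the nonzero coordinates to the boundary of the box.\<close>

section \<open>Superadditivity and concavity of real powers\<close>

lemma powr_mult_powr_diff_one:
  fixes x r :: real
  assumes "0 \<le> x"
  shows "x powr r = x * x powr (r - 1)"
  using assms by (cases "x = 0") (simp_all add: powr_diff)

text \<open>Each \<open>a i\<close> is at most the total \<open>S\<close>, so
  \<open>a i powr (r - 1) \<le> S powr (r - 1)\<close>; multiplying by \<open>a i\<close> and
  summing restores the missing power of \<open>S\<close>.\<close>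

lemma sum_powr_le_powr_sum:
  fixes a :: "'a \<Rightarrow> real"
  assumes "finite I" "\<And>i. i \<in> I \<Longrightarrow> 0 \<le> a i" "1 \<le> r"
  shows "(\<Sum>i\<in>I. a i powr r) \<le> (\<Sum>i\<in>I. a i) powr r"
proof -
  let ?S = "\<Sum>i\<in>I. a i"
  have "(\<Sum>i\<in>I. a i powr r) \<le> (\<Sum>i\<in>I. a i * ?S powr (r - 1))"
  proof (rule sum_mono)
    fix i assume i: "i \<in> I"
    have "a i powr (r - 1) \<le> ?S powr (r - 1)"
      using assms i by (intro powr_mono2 member_le_sum) auto
    then show "a i powr r \<le> a i * ?S powr (r - 1)"
      using assms(2)[OF i] powr_mult_powr_diff_one[of "a i" r] by (simp add: mult_left_mono)
  qed
  also have "\<dots> = ?S powr r"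
    using assms powr_mult_powr_diff_one[of ?S r] by (simp add: sum_distrib_right sum_nonneg)
  finally show ?thesis .
qed

lemma powr_add_powr_le:
  fixes a b r :: real
  assumes "0 \<le> a" "0 \<le> b" "1 \<le> r"
  shows "a powr r + b powr r \<le> (a + b) powr r"
  using sum_powr_le_powr_sum[of "UNIV :: bool set" "\<lambda>t. if t then a else b" r] assms
  by (simp add: UNIV_bool add.commute)

lemma powr_add_powr_less:
  fixes a b r :: real
  assumes "0 < a" "0 < b" "1 < r"
  shows "a powr r + b powr r < (a + b) powr r"
proof -
  have "a powr (r - 1) < (a + b) powr (r - 1)" "b powr (r - 1) < (a + b) powr (r - 1)"
    using assms by (auto intro!: powr_less_mono2)
  then have "a * a powr (r - 1) + b * b powr (r - 1)
      < a * (a + b) powr (r - 1) + b * (a + b) powr (r - 1)"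
    using assms by (intro add_strict_mono mult_strict_left_mono) auto
  then show ?thesis
    using assms powr_mult_powr_diff_one[of a r] powr_mult_powr_diff_one[of b r]
      powr_mult_powr_diff_one[of "a + b" r] by (simp add: distrib_right)
qed

text \<open>Divided by \<open>s * (R - s)\<close>, this says that the chord of \<open>G\<close> over
  \<open>[s, R]\<close> has smaller slope than the chord over \<open>[0, s]\<close>. The mean value
  theorem turns both slopes into values of a strictly decreasing derivative. The condition
  \<open>q < 1 \<or> 0 < c\<close> excludes the case where \<open>G\<close> is the identity on
  \<open>t \<ge> 0\<close>.\<close>

lemma add_powr_powr_chord_less:
  fixes c p q R s :: real
  assumes p: "0 < p" "p < 1" and q: "p \<le> q" "q \<le> 1" and c: "0 \<le> c" "q < 1 \<or> 0 < c"
    and s: "0 < s" "s < R"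
  defines "G \<equiv> \<lambda>t. (c + t powr p) powr (q / p)"
  shows "(G R - G s) * s < (G s - G 0) * (R - s)"
proof -
  define r where "r = q / p"
  \<comment> \<open>\<open>D\<close> is the derivative of \<open>G\<close> with a power of \<open>t\<close> extracted so that both factors are decreasing.\<close>
  define D where "D = (\<lambda>t. q * (t powr (q - 1) * (c * t powr (- p) + 1) powr (r - 1)))"
  have r: "1 \<le> r" "p * r = q" using p q by (auto simp: r_def field_simps)
  have deriv: "(G has_real_derivative D t) (at t)" if t: "0 < t" for t
  proof -
    have pos: "0 < c + t powr p" using c t by (simp add: add_nonneg_pos)
    have "(G has_real_derivative r * (c + t powr p) powr (r - 1) * (p * t powr (p - 1))) (at t)"
      unfolding G_def r_def[symmetric] using t pos
      by (auto intro!: derivative_eq_intros simp: powr_diff field_simps)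
    \<comment> \<open>Pulling \<open>t powr p\<close> out of the base leaves the factor
      \<open>t powr (p * (r - 1))\<close>, and \<open>p * r = q\<close>.\<close>
    moreover have "(c + t powr p) powr (r - 1)
        = t powr (q - p) * (c * t powr (- p) + 1) powr (r - 1)"
    proof -
      have "c + t powr p = t powr p * (c * t powr (- p) + 1)"
        using t by (simp add: powr_minus field_simps)
      then show ?thesis
        using t c r by (simp add: powr_mult powr_powr right_diff_distrib)
    qed
    moreover have "r * (t powr (q - p) * X) * (p * t powr (p - 1)) = p * r * (t powr (q - 1) * X)" for X
    proof -
      have "t powr (q - p) * t powr (p - 1) = t powr (q - 1)"
        by (simp flip: powr_add)
      moreover have "r * (t powr (q - p) * X) * (p * t powr (p - 1))
          = p * r * ((t powr (q - p) * t powr (p - 1)) * X)"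
        by (simp only: mult_ac)
      ultimately show ?thesis by simp
    qed
    ultimately show ?thesis
      by (simp add: D_def r(2))
  qed
  have dec: "D t < D z" if z: "0 < z" "z < t" for z t
  proof -
    have P: "t powr (- p) < z powr (- p)" using z p by (intro powr_less_mono2_neg) auto
    have A: "t powr (q - 1) \<le> z powr (q - 1)"
      using z q by (intro powr_mono2') auto
    have B: "(c * t powr (- p) + 1) powr (r - 1) \<le> (c * z powr (- p) + 1) powr (r - 1)"
      using r c by (intro powr_mono2 add_right_mono mult_left_mono less_imp_le[OF P]) auto
    have "0 < c * t powr (- p) + 1" using c by (intro add_nonneg_pos) auto
    then have pos: "0 < z powr (q - 1)" "0 < (c * t powr (- p) + 1) powr (r - 1)"
      using z by auto
    have "t powr (q - 1) * (c * t powr (- p) + 1) powr (r - 1)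
        < z powr (q - 1) * (c * z powr (- p) + 1) powr (r - 1)"
    \<comment> \<open>One factor has to decrease strictly: the first if \<open>q < 1\<close>,
      otherwise the second, since then \<open>r > 1\<close> and \<open>c > 0\<close>.\<close>
    proof (cases "q < 1")
      case True
      then have "t powr (q - 1) < z powr (q - 1)" using z by (intro powr_less_mono2_neg) auto
      then show ?thesis using B pos by (intro mult_less_le_imp_less) auto
    next
      case False
      then have "0 < c" "1 < r" using c p q by (auto simp: r_def)
      then have "(c * t powr (- p) + 1) powr (r - 1) < (c * z powr (- p) + 1) powr (r - 1)"
        using P by (intro powr_less_mono2) auto
      then show ?thesis using A z by (intro mult_le_less_imp_less) auto
    qed
    then show ?thesis using p q by (simp add: D_def)
  qed
  \<comment> \<open>The derivative formula covers only \<open>t > 0\<close>; the chord starting at 0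
    also needs continuity at 0.\<close>
  have cont: "continuous_on {a..b} G" if "0 \<le> a" for a b
    unfolding G_def using that p q c
    by (intro continuous_intros continuous_on_powr') (auto intro!: add_nonneg_nonneg)
  have mvt: "\<exists>z>a. z < b \<and> G b - G a = (b - a) * D z" if ab: "a < b" "0 \<le> a" for a b
  proof -
    have "G differentiable (at t)" if "a < t" for t
      using deriv[of t] ab that by (auto simp: real_differentiable_def)
    then obtain l z where "a < z" "z < b" "DERIV G z :> l" "G b - G a = (b - a) * l"
      using MVT[OF ab(1) cont] ab by blast
    moreover from this have "l = D z" using deriv[of z] ab DERIV_unique by auto
    ultimately show ?thesis by auto
  qed
  obtain z w where "0 < z" "z < s" "G s - G 0 = s * D z" "s < w" "G R - G s = (R - s) * D w"
    using mvt[of 0 s] mvt[of s R] s by auto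
  moreover have "s * (R - s) * D w < s * (R - s) * D z"
    using calculation s by (intro mult_strict_left_mono dec) auto
  ultimately show ?thesis by (simp add: ac_simps)
qed

lemma lp_norm_powr: "lp_norm p w powr q = (\<Sum>j\<in>UNIV. \<bar>w $ j\<bar> powr p) powr (q / p)"
  by (simp add: lp_norm_def powr_powr)

section \<open>The finite-dimensional minimization on one grid interval\<close>

locale box_minimizer =
  fixes p q g :: real and f \<rho> v :: "real^'m"
  assumes p: "0 < p" "p < 1" and q: "p \<le> q" "q \<le> 1" and g: "0 < g"
    and \<rho>: "\<And>i. 0 < \<rho> $ i"
    and in_box: "v \<in> control_box \<rho>"
    and minimal: "\<And>w. w \<in> control_box \<rho> \<Longrightarrow>
      f \<bullet> v + g * lp_norm p v powr q \<le> f \<bullet> w + g * lp_norm p w powr q"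
begin

text \<open>With the other coordinates frozen, the penalty in coordinate \<open>i\<close> is
  \<open>(rest i + t powr p) powr (q / p)\<close> at modulus \<open>t\<close>, so
  \<open>rest i\<close> is the constant \<open>c\<close> of
  \<open>add_powr_powr_chord_less\<close>.\<close>

definition rest :: "'m \<Rightarrow> real" where
  "rest i = (\<Sum>j\<in>UNIV - {i}. \<bar>v $ j\<bar> powr p)"

lemma rest_nonneg: "0 \<le> rest i"
  by (simp add: rest_def sum_nonneg)

lemma rest_pos: "j \<noteq> i \<Longrightarrow> v $ j \<noteq> 0 \<Longrightarrow> 0 < rest i"
  unfolding rest_def by (rule sum_pos2[of _ j]) auto

lemma abs_le: "\<bar>v $ i\<bar> \<le> \<rho> $ i"
  using in_box by (auto simp: control_box_def abs_le_iff minus_le_iff)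

lemma exponent_ge_1: "1 \<le> q / p"
  using p q by simp

lemma exponent_gt_1: "p < q \<Longrightarrow> 1 < q / p"
  using p by simp

lemma coordinate_minimal:
  assumes "\<bar>s\<bar> \<le> \<rho> $ i"
  shows "f $ i * v $ i + g * (rest i + \<bar>v $ i\<bar> powr p) powr (q / p)
    \<le> f $ i * s + g * (rest i + \<bar>s\<bar> powr p) powr (q / p)"
proof -
  let ?w = "\<chi> j. if j = i then s else v $ j"
  have split: "f \<bullet> z = f $ i * z $ i + (\<Sum>j\<in>UNIV - {i}. f $ j * v $ j)"
      "(\<Sum>j\<in>UNIV. \<bar>z $ j\<bar> powr p) = rest i + \<bar>z $ i\<bar> powr p"
    if "\<And>j. j \<noteq> i \<Longrightarrow> z $ j = v $ j" for z
    using that by (auto simp: inner_vec_def rest_def sum.remove[of UNIV i] intro!: sum.cong)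
  have "?w \<in> control_box \<rho>"
    using in_box assms by (auto simp: control_box_def)
  from minimal[OF this] split[of v] split[of ?w] show ?thesis
    by (simp add: lp_norm_powr)
qed

lemma penalty_superadditive:
  "rest i powr (q / p) + \<bar>v $ i\<bar> powr q \<le> (rest i + \<bar>v $ i\<bar> powr p) powr (q / p)"
  using powr_add_powr_le[OF rest_nonneg _ exponent_ge_1, of "\<bar>v $ i\<bar> powr p" i] p
  by (simp add: powr_powr)

lemma penalty_strictly_superadditive:
  assumes "p < q" "v $ i \<noteq> 0" "0 < rest i"
  shows "rest i powr (q / p) + \<bar>v $ i\<bar> powr q < (rest i + \<bar>v $ i\<bar> powr p) powr (q / p)"
  using powr_add_powr_less[OF assms(3) _ exponent_gt_1[OF assms(1)], of "\<bar>v $ i\<bar> powr p"] p assms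
  by (simp add: powr_powr)

lemma removal_bound:
  "f $ i * v $ i + g * ((rest i + \<bar>v $ i\<bar> powr p) powr (q / p) - rest i powr (q / p)) \<le> 0"
  using coordinate_minimal[of 0 i] \<rho>[of i] by (simp add: right_diff_distrib)

text \<open>By superadditivity, coordinate \<open>i\<close> adds at least its stand-alone cost to
  the penalty, so its linear term has to pay for that cost.\<close>

lemma coordinate_bound: "f $ i * v $ i + g * \<bar>v $ i\<bar> powr q \<le> 0"
proof -
  have "g * \<bar>v $ i\<bar> powr q
      \<le> g * ((rest i + \<bar>v $ i\<bar> powr p) powr (q / p) - rest i powr (q / p))"
    using penalty_superadditive[of i] g by (intro mult_left_mono) auto
  then show ?thesis using removal_bound[of i] by linarith
qed

lemma coordinate_bound_strict:
  assumes "p < q" "v $ i \<noteq> 0" "0 < rest i"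
  shows "f $ i * v $ i + g * \<bar>v $ i\<bar> powr q < 0"
proof -
  have "g * \<bar>v $ i\<bar> powr q
      < g * ((rest i + \<bar>v $ i\<bar> powr p) powr (q / p) - rest i powr (q / p))"
    using penalty_strictly_superadditive[OF assms] g by (intro mult_strict_left_mono) auto
  then show ?thesis using removal_bound[of i] by linarith
qed

text \<open>Splitting off \<open>\<bar>v $ i\<bar> powr (1 - q)\<close> and bounding it by the box
  size makes the linear term comparable with the penalty. The resulting factor is the quantity that
  the index sets compare with \<open>g\<close>.\<close>

lemma linear_term_ge:
  "- (\<bar>f $ i\<bar> * \<rho> $ i powr (1 - q)) * \<bar>v $ i\<bar> powr q \<le> f $ i * v $ i"
proof -
  have "\<bar>v $ i\<bar> = \<bar>v $ i\<bar> powr (1 - q) * \<bar>v $ i\<bar> powr q"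
    by (simp flip: powr_add)
  also have "\<dots> \<le> \<rho> $ i powr (1 - q) * \<bar>v $ i\<bar> powr q"
    using q abs_le by (intro mult_right_mono powr_mono2) auto
  finally have "\<bar>f $ i * v $ i\<bar> \<le> \<bar>f $ i\<bar> * (\<rho> $ i powr (1 - q) * \<bar>v $ i\<bar> powr q)"
    by (simp add: abs_mult mult_left_mono)
  then show ?thesis by (simp add: mult.assoc abs_le_iff)
qed

lemma zero_on_minus:
  assumes "i \<in> idx_minus \<rho> q f g"
  shows "v $ i = 0"
proof (rule ccontr)
  assume "v $ i \<noteq> 0"
  then have "\<bar>f $ i\<bar> * \<rho> $ i powr (1 - q) * \<bar>v $ i\<bar> powr q < g * \<bar>v $ i\<bar> powr q"
    using assms by (intro mult_strict_right_mono) (auto simp: idx_minus_def)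
  then show False using linear_term_ge[of i] coordinate_bound[of i] by simp
qed

text \<open>At the threshold, \<open>linear_term_ge\<close> and \<open>coordinate_bound\<close>
  leave no slack, whereas a second nonzero coordinate would make the latter strict.\<close>

lemma rest_eq_0_on_zero:
  assumes "i \<in> idx_zero \<rho> q f g" "p < q" "v $ i \<noteq> 0"
  shows "rest i = 0"
proof (rule ccontr)
  assume "rest i \<noteq> 0"
  then have "0 < rest i" using rest_nonneg[of i] by simp
  from coordinate_bound_strict[OF assms(2,3) this] show False
    using linear_term_ge[of i] assms(1) by (simp add: idx_zero_def)
qed

lemma product_zero_on_zero:
  assumes "i \<in> idx_zero \<rho> q f g" "p < q" "i \<noteq> j"
  shows "v $ i * v $ j = 0"
  using rest_eq_0_on_zero[OF assms(1,2)] rest_pos[of j i] assms(3) by fastforce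

lemma minimum_neg:
  assumes "i \<in> idx_plus \<rho> q f g"
  shows "f \<bullet> v + g * (\<Sum>j\<in>UNIV. \<bar>v $ j\<bar> powr p) powr (q / p) < 0"
proof -
  \<comment> \<open>The test vector uses coordinate \<open>i\<close> alone, at the favourable end of
    the box. Its value is \<open>\<rho> $ i powr q * (g - \<bar>f $ i\<bar> * \<rho> $ i powr (1 -
    q))\<close>, which is negative on \<open>idx_plus\<close>.\<close>
  let ?w = "axis i (- \<rho> $ i * sgn (f $ i))"
  have "0 < \<bar>f $ i\<bar> * \<rho> $ i powr (1 - q)"
    using assms g by (simp add: idx_plus_def)
  then have f: "f $ i \<noteq> 0" by auto
  have "?w \<in> control_box \<rho>"
    using \<rho> by (auto simp: control_box_def axis_def sgn_if less_imp_le)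
  note minimal[OF this]
  moreover have "f \<bullet> ?w = - (\<bar>f $ i\<bar> * \<rho> $ i)"
    by (simp add: inner_axis abs_sgn)
  moreover have "(\<Sum>j\<in>UNIV. \<bar>?w $ j\<bar> powr p) = \<rho> $ i powr p"
    using f \<rho>[of i] p by (simp add: sum.remove[of UNIV i] axis_def abs_mult abs_sgn_eq)
  moreover have "\<bar>f $ i\<bar> * \<rho> $ i = \<bar>f $ i\<bar> * \<rho> $ i powr (1 - q) * \<rho> $ i powr q"
    using \<rho>[of i] by (simp add: mult.assoc flip: powr_add)
  moreover have "g * \<rho> $ i powr q < \<bar>f $ i\<bar> * \<rho> $ i powr (1 - q) * \<rho> $ i powr q"
    using assms \<rho>[of i] by (intro mult_strict_right_mono) (auto simp: idx_plus_def)
  ultimately show ?thesis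
    using p by (simp add: lp_norm_powr powr_powr)
qed

text \<open>A nonzero \<open>v $ i\<close> would be the only nonzero coordinate, and at the
  threshold the minimum would then be nonnegative, against \<open>minimum_neg\<close>.\<close>

lemma zero_on_zero:
  assumes "i \<in> idx_zero \<rho> q f g" "p < q" "idx_plus \<rho> q f g \<noteq> {}"
  shows "v $ i = 0"
proof (rule ccontr)
  assume i: "v $ i \<noteq> 0"
  have others: "v $ j = 0" if "j \<noteq> i" for j
    using rest_eq_0_on_zero[OF assms(1,2) i] rest_pos[OF that] by fastforce
  have "f \<bullet> v = f $ i * v $ i" "(\<Sum>j\<in>UNIV. \<bar>v $ j\<bar> powr p) = \<bar>v $ i\<bar> powr p"
    using others by (simp_all add: inner_vec_def sum.remove[of UNIV i])
  moreover obtain k where "k \<in> idx_plus \<rho> q f g" using assms(3) by auto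
  ultimately show False
    using minimum_neg[of k] linear_term_ge[of i] assms(1) p by (simp add: idx_zero_def powr_powr)
qed

text \<open>Coordinates outside \<open>idx_plus\<close> cannot pay for their stand-alone cost. If
  those inside vanish, summing over all coordinates and using superadditivity makes the minimum
  nonnegative.\<close>

lemma nonzero_on_plus:
  assumes "idx_plus \<rho> q f g \<noteq> {}"
  shows "\<exists>i\<in>idx_plus \<rho> q f g. v $ i \<noteq> 0"
proof (rule ccontr)
  assume "\<not> ?thesis"
  then have zero: "v $ i = 0" if "i \<in> idx_plus \<rho> q f g" for i using that by blast
  have "0 \<le> f $ i * v $ i + g * \<bar>v $ i\<bar> powr q" for i
  proof (cases "i \<in> idx_plus \<rho> q f g")
    case True
    then show ?thesis using zero g by simp
  next
    case False
    then have "\<bar>f $ i\<bar> * \<rho> $ i powr (1 - q) * \<bar>v $ i\<bar> powr q \<le> g * \<bar>v $ i\<bar> powr q"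
      by (intro mult_right_mono) (auto simp: idx_plus_def)
    then show ?thesis using linear_term_ge[of i] by simp
  qed
  then have "0 \<le> (\<Sum>i\<in>UNIV. f $ i * v $ i + g * \<bar>v $ i\<bar> powr q)"
    by (intro sum_nonneg)
  also have "\<dots> = f \<bullet> v + g * (\<Sum>i\<in>UNIV. (\<bar>v $ i\<bar> powr p) powr (q / p))"
    using p by (simp add: inner_vec_def sum.distrib sum_distrib_left powr_powr)
  also have "\<dots> \<le> f \<bullet> v + g * (\<Sum>i\<in>UNIV. \<bar>v $ i\<bar> powr p) powr (q / p)"
    using g exponent_ge_1 by (intro add_left_mono mult_left_mono sum_powr_le_powr_sum) auto
  finally show False using minimum_neg assms by fastforce
qed

lemma eq_minus_sgn_mult_abs: "v $ i = - sgn (f $ i) * \<bar>v $ i\<bar>"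
proof (cases "v $ i = 0")
  case False
  then have "f $ i * v $ i < 0"
    using coordinate_bound[of i] g by (smt (verit) mult_pos_pos powr_gt_zero zero_less_abs_iff)
  then show ?thesis by (auto simp: mult_less_0_iff)
qed simp

text \<open>A value strictly between the two ends would be minimal along its ray, which strict
  concavity forbids. The assumption \<open>nonlin\<close> leaves one linear case,
  \<open>q = 1\<close> and \<open>rest i = 0\<close>, and there \<open>i\<close> lies in
  \<open>idx_plus\<close>.\<close>

lemma bang_bang:
  assumes nonlin: "q < 1 \<or> 0 < rest i \<or> i \<in> idx_plus \<rho> q f g"
  shows "v $ i \<in> {0, - \<rho> $ i * sgn (f $ i)}"
proof (rule ccontr)
  assume *: "v $ i \<notin> {0, - \<rho> $ i * sgn (f $ i)}"
  define s R where "s = \<bar>v $ i\<bar>" and "R = \<rho> $ i"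
  define G where "G = (\<lambda>t. (rest i + t powr p) powr (q / p))"
  have "s \<noteq> R" using * eq_minus_sgn_mult_abs[of i] by (auto simp: s_def R_def mult.commute)
  then have s: "0 < s" "s < R" using * abs_le[of i] by (auto simp: s_def R_def)
  have f: "f $ i \<noteq> 0" using * eq_minus_sgn_mult_abs[of i] by auto
  have "f $ i * v $ i = - \<bar>f $ i\<bar> * s"
    unfolding s_def by (subst eq_minus_sgn_mult_abs) (simp add: abs_sgn)
  \<comment> \<open>By the sign rule, \<open>v $ i\<close> is the point with parameter
    \<open>s\<close> on the ray of points \<open>- sgn (f $ i) * t\<close>, so a scalar problem on
    \<open>[0, R]\<close> remains.\<close>
  then have le: "- \<bar>f $ i\<bar> * s + g * G s \<le> - \<bar>f $ i\<bar> * t + g * G t" if "0 \<le> t" "t \<le> R" for t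
    using coordinate_minimal[of "- sgn (f $ i) * t" i] that f
    by (simp add: R_def G_def s_def abs_mult abs_sgn_eq abs_sgn[of "f $ i"])
  have "g * (G s - G 0) \<le> \<bar>f $ i\<bar> * s" "\<bar>f $ i\<bar> * (R - s) \<le> g * (G R - G s)"
    using le[of 0] le[of R] s by (auto simp: algebra_simps)
  \<comment> \<open>Cross-multiplying gives both inequalities the common term
    \<open>\<bar>f $ i\<bar> * s * (R - s)\<close>, which eliminates \<open>f\<close>.\<close>
  then have "g * (G s - G 0) * (R - s) \<le> \<bar>f $ i\<bar> * s * (R - s)"
      "\<bar>f $ i\<bar> * (R - s) * s \<le> g * (G R - G s) * s"
    using s by (auto intro!: mult_right_mono)
  then have chord: "g * ((G s - G 0) * (R - s)) \<le> g * ((G R - G s) * s)"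
    by (simp add: mult_ac)
  show False
  proof (cases "q < 1 \<or> 0 < rest i")
    case True
    then show False
      using add_powr_powr_chord_less[OF p q rest_nonneg True s] g chord by (simp add: G_def)
  next
    case False
    \<comment> \<open>Since \<open>\<rho> $ i powr 0 = 1\<close>, membership in
      \<open>idx_plus\<close> reads \<open>g < \<bar>f $ i\<bar>\<close>. On the ray the objective
      is \<open>(g - \<bar>f $ i\<bar>) * t\<close>, so moving from \<open>s\<close> to
      \<open>R\<close> lowers it.\<close>
    then have "q = 1" "rest i = 0" "g < \<bar>f $ i\<bar>"
      using q rest_nonneg[of i] nonlin by (auto simp: idx_plus_def \<rho> less_imp_neq[OF \<rho>, symmetric])
    then have "(\<bar>f $ i\<bar> - g) * (R - s) \<le> 0"
      using le[of R] s p by (simp add: G_def powr_powr algebra_simps)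
    then show False using \<open>g < \<bar>f $ i\<bar>\<close> s by (simp add: mult_le_0_iff)
  qed
qed

lemma in_segment: "v $ i \<in> closed_segment 0 (- \<rho> $ i * sgn (f $ i))"
proof -
  have "v $ i = (\<bar>v $ i\<bar> / \<rho> $ i) *\<^sub>R (- \<rho> $ i * sgn (f $ i))"
    using eq_minus_sgn_mult_abs[of i] \<rho>[of i] by (simp add: field_simps)
  then show ?thesis
    using \<rho>[of i] abs_le[of i]
    by (auto simp: in_segment intro!: exI[of _ "\<bar>v $ i\<bar> / \<rho> $ i"])
qed

end

section \<open>Integrals over grid intervals\<close>

text \<open>On a bounded interval \<open>norm (z t)\<close> is dominated by the integrable function
  \<open>1 + exp (lam * t) * (norm (z t))\<^sup>2\<close>. The argument runs on the open interval,
  as \<open>z\<close> is controlled only for positive times; the endpoint \<open>a\<close> is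
  negligible.\<close>

lemma integrable_on_if_L2_weighted:
  fixes z :: "real \<Rightarrow> real^'d"
  assumes z: "z \<in> L2_weighted lam" and lam: "0 \<le> lam" and a: "0 \<le> a"
  shows "z integrable_on {a..<b}"
proof -
  have sub: "{a<..<b} \<subseteq> {0<..}" using a by auto
  have z': "z \<in> borel_measurable (lebesgue_on {0<..})"
    "integrable (lebesgue_on {0<..}) (\<lambda>t. exp (lam * t) * (norm (z t))\<^sup>2)"
    using z by (auto simp: L2_weighted_def)
  have "z \<in> borel_measurable (lebesgue_on {a<..<b})"
    using measurable_restrict_mono[OF z'(1) sub] .
  moreover have "(\<lambda>t. 1 + exp (lam * t) * (norm (z t))\<^sup>2) absolutely_integrable_on {a<..<b}"
  proof (intro set_integral_add)
    have "set_integrable lebesgue {0<..} (\<lambda>t. exp (lam * t) * (norm (z t))\<^sup>2)"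
      using z'(2) by (simp add: set_integrable_def integrable_restrict_space)
    then show "set_integrable lebesgue {a<..<b} (\<lambda>t. exp (lam * t) * (norm (z t))\<^sup>2)"
      by (rule set_integrable_subset) (use sub in auto)
  qed (rule absolutely_integrable_on_const, simp)
  then have "(\<lambda>t. 1 + exp (lam * t) * (norm (z t))\<^sup>2) integrable_on {a<..<b}"
    by (simp add: set_lebesgue_integral_eq_integral)
  moreover have "norm (z t) \<le> 1 + exp (lam * t) * (norm (z t))\<^sup>2" if "t \<in> {a<..<b}" for t
  proof -
    have "norm (z t) \<le> 1 + (norm (z t))\<^sup>2"
      using zero_le_power2[of "norm (z t) - 1"] by (simp add: power2_diff) (smt (verit) norm_ge_zero)
    moreover have "1 * (norm (z t))\<^sup>2 \<le> exp (lam * t) * (norm (z t))\<^sup>2"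
      using lam a that by (intro mult_right_mono) auto
    ultimately show ?thesis by simp
  qed
  ultimately have "z integrable_on {a<..<b}"
    by (rule measurable_bounded_by_integrable_imp_integrable) (simp_all add: fmeasurableD)
  then show ?thesis
  proof (rule integrable_spike_set)
    show "negligible {t \<in> {a<..<b} - {a..<b}. z t \<noteq> 0}"
      by (rule negligible_subset[of "{}"]) auto
    show "negligible {t \<in> {a..<b} - {a<..<b}. z t \<noteq> 0}"
      by (rule negligible_subset[of "{a}"]) auto
  qed
qed

lemma grid_weight_pos:
  assumes "temporal_grid \<tau>"
  shows "0 < grid_weight lam \<tau> k"
proof -
  have less: "\<tau> k < \<tau> (Suc k)"
    using assms by (auto simp: temporal_grid_def strict_mono_def)
  have "continuous_on {\<tau> k..\<tau> (Suc k)} (\<lambda>t. exp (- lam * t))"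
    by (intro continuous_intros)
  then have "0 < integral {\<tau> k..\<tau> (Suc k)} (\<lambda>t. exp (- lam * t))"
    using integral_less_real[of "\<tau> k" "\<tau> (Suc k)" "\<lambda>_. 0" "\<lambda>t. exp (- lam * t)"] less
    by simp
  also have "\<dots> = grid_weight lam \<tau> k"
    unfolding grid_weight_def grid_interval_def
  proof (rule integral_spike_set)
    show "negligible {t \<in> {\<tau> k..\<tau> (Suc k)} - {\<tau> k..<\<tau> (Suc k)}. exp (- lam * t) \<noteq> 0}"
      by (rule negligible_subset[of "{\<tau> (Suc k)}"]) auto
    show "negligible {t \<in> {\<tau> k..<\<tau> (Suc k)} - {\<tau> k..\<tau> (Suc k)}. exp (- lam * t) \<noteq> 0}"
      by (rule negligible_subset[of "{}"]) auto
  qed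
  finally show ?thesis .
qed

text \<open>Moving \<open>B\<close> across the inner product lets the constant \<open>w\<close>
  leave the integral, so the integral term is a linear form in \<open>w\<close>. Integrability keeps
  \<open>integral\<close> from being a default value.\<close>

lemma integral_inner_matrix_vector:
  assumes "\<phi> integrable_on grid_interval \<tau> k"
  shows "integral (grid_interval \<tau> k) (\<lambda>s. \<phi> s \<bullet> (B *v w)) = adjoint_moment B \<tau> \<phi> k \<bullet> w"
proof -
  have "(\<lambda>s. transpose B *v \<phi> s) integrable_on grid_interval \<tau> k"
    using integrable_linear[OF assms matrix_vector_mul_bounded_linear[of "transpose B"]]
    by (simp add: o_def)
  from integral_linear[OF this bounded_linear_inner_left[of w]] show ?thesis
    by (simp add: o_def adjoint_moment_def dot_lmul_matrix)
qed

text \<open>For \<open>p = q\<close> the penalty is a separable sum, so each coordinate in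
  \<open>I0 k\<close> may be zero or at its nonzero endpoint independently of the others. Hence the
  vanishing and product claims carry \<open>p < q\<close>, which is automatic when
  \<open>q = 1\<close>. The last claim is guarded because \<open>Max {}\<close> is
  unspecified.\<close>

theorem theorem5p4:
  fixes A :: "real^'d^'d" and B :: "real^'m^'d"
    and x y\<^sub>d :: "real^'d" and \<rho> :: "real^'m"
    and p q \<gamma> lam :: real
    and \<tau> :: "nat \<Rightarrow> real"
    and u :: "real \<Rightarrow> real^'m" and y \<phi> :: "real \<Rightarrow> real^'d"
    and b \<gamma>' :: "nat \<Rightarrow> real" and \<Phi> :: "nat \<Rightarrow> real^'m"
    and Im I0 Ip :: "nat \<Rightarrow> 'm set"
  assumes p: "0 < p" "p < 1"
    and q: "p \<le> q" "q \<le> 1"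
    and \<gamma>: "0 < \<gamma>"
    and lam: "lam > max 0 (2 * spectral_abscissa A)"
    and grid: "temporal_grid \<tau>"
    and \<rho>: "\<And>i. 0 < \<rho> $ i"
    and b: "\<And>k. b k = grid_weight lam \<tau> k"
    and u: "u \<in> grid_controls \<tau> (control_box \<rho>)"
    and y: "trajectory A B x u y"
    and \<phi>: "adjoint_state A lam y\<^sub>d y \<phi>"
    and argmin: "\<And>k t. t \<in> grid_interval \<tau> k \<Longrightarrow>
      is_arg_min
        (\<lambda>v. integral (grid_interval \<tau> k) (\<lambda>s. \<phi> s \<bullet> (B *v v)) + \<gamma> * b k * lp_norm p v powr q)
        (\<lambda>v. v \<in> control_box \<rho>) (u t)"
    and \<Phi>: "\<And>k. \<Phi> k = adjoint_moment B \<tau> \<phi> k"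
    and \<gamma>': "\<And>k. \<gamma>' k = \<gamma> * b k"
    and Im: "\<And>k. Im k = idx_minus \<rho> q (\<Phi> k) (\<gamma>' k)"
    and I0: "\<And>k. I0 k = idx_zero \<rho> q (\<Phi> k) (\<gamma>' k)"
    and Ip: "\<And>k. Ip k = idx_plus \<rho> q (\<Phi> k) (\<gamma>' k)"
  shows
    "(\<forall>k. \<forall>t \<in> grid_interval \<tau> k. \<forall>i \<in> Im k. u t $ i = 0) \<and>
     (\<forall>k. \<forall>t \<in> grid_interval \<tau> k.
        (p < q \<longrightarrow> Ip k \<noteq> {} \<longrightarrow> (\<forall>i \<in> I0 k. u t $ i = 0)) \<and>
        (Ip k = {} \<and> q < 1 \<longrightarrow>
           (\<forall>i \<in> I0 k. u t $ i \<in> {0, - \<rho> $ i * sgn (\<Phi> k $ i)}) \<and>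
           (p < q \<longrightarrow> (\<forall>i \<in> I0 k. \<forall>j \<in> I0 k. i \<noteq> j \<longrightarrow> u t $ i * u t $ j = 0))) \<and>
        (Ip k = {} \<and> q = 1 \<longrightarrow>
           (\<forall>i \<in> I0 k. u t $ i \<in> closed_segment 0 (- \<rho> $ i * sgn (\<Phi> k $ i))) \<and>
           (\<forall>i \<in> I0 k. \<forall>j \<in> I0 k. i \<noteq> j \<longrightarrow> u t $ i * u t $ j = 0))) \<and>
     (\<forall>k. \<forall>t \<in> grid_interval \<tau> k.
        (\<forall>i \<in> Ip k. u t $ i \<in> {0, - \<rho> $ i * sgn (\<Phi> k $ i)}) \<and>
        (Ip k \<noteq> {} \<longrightarrow> Max ((\<lambda>i. \<bar>u t $ i\<bar>) ` Ip k) \<noteq> 0))"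
proof -
  have "0 \<le> lam" using lam by simp
  moreover have "0 \<le> \<tau> k" for k
    using grid strict_mono_leD[of \<tau> 0 k] by (auto simp: temporal_grid_def)
  ultimately have "\<phi> integrable_on grid_interval \<tau> k" for k
    unfolding grid_interval_def using \<phi>
    by (intro integrable_on_if_L2_weighted) (auto simp: adjoint_state_def)
  then have moment:
      "integral (grid_interval \<tau> k) (\<lambda>s. \<phi> s \<bullet> (B *v w)) = \<Phi> k \<bullet> w" for k w
    unfolding \<Phi> by (rule integral_inner_matrix_vector)
  have minimizer: "box_minimizer p q (\<gamma>' k) (\<Phi> k) \<rho> (u t)" if "t \<in> grid_interval \<tau> k" for k t
  proof
    show "0 < \<gamma>' k" using \<gamma> grid_weight_pos[OF grid] by (simp add: \<gamma>' b)
  qed (use p q \<rho> argmin[OF that] in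
      \<open>auto simp: is_arg_min_def moment \<gamma>' linorder_not_less\<close>)
  show ?thesis
  proof (intro conjI allI ballI impI)
    fix k t i assume t: "t \<in> grid_interval \<tau> k"
    interpret box_minimizer p q "\<gamma>' k" "\<Phi> k" \<rho> "u t" using minimizer[OF t] .
    show "u t $ i = 0" if "i \<in> Im k" using that zero_on_minus by (simp add: Im)
    show "u t $ i = 0" if "p < q" "Ip k \<noteq> {}" "i \<in> I0 k"
      using that zero_on_zero by (simp add: I0 Ip)
    show "u t $ i \<in> {0, - \<rho> $ i * sgn (\<Phi> k $ i)}" if "Ip k = {} \<and> q < 1"
      using that bang_bang by blast
    show "u t $ i * u t $ j = 0" if "p < q" "i \<in> I0 k" "i \<noteq> j" for j
      using that product_zero_on_zero by (simp add: I0)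
    \<comment> \<open>Here \<open>p < 1 = q\<close> supplies the strict inequality.\<close>
    show "u t $ i * u t $ j = 0" if "Ip k = {} \<and> q = 1" "i \<in> I0 k" "i \<noteq> j" for j
      using that p product_zero_on_zero by (simp add: I0)
    show "u t $ i \<in> closed_segment 0 (- \<rho> $ i * sgn (\<Phi> k $ i))"
      using in_segment .
    show "u t $ i \<in> {0, - \<rho> $ i * sgn (\<Phi> k $ i)}" if "i \<in> Ip k"
      using that bang_bang unfolding Ip by blast
  next
    fix k t assume t: "t \<in> grid_interval \<tau> k" and ne: "Ip k \<noteq> {}"
    interpret box_minimizer p q "\<gamma>' k" "\<Phi> k" \<rho> "u t" using minimizer[OF t] .
    obtain i where i: "i \<in> Ip k" "u t $ i \<noteq> 0"
      using nonzero_on_plus ne unfolding Ip by blast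
    then have "0 < \<bar>u t $ i\<bar>" by simp
    also have "\<dots> \<le> Max ((\<lambda>i. \<bar>u t $ i\<bar>) ` Ip k)" using i by (intro Max_ge) auto
    finally show "Max ((\<lambda>i. \<bar>u t $ i\<bar>) ` Ip k) \<noteq> 0" by simp
  qed
qed

end
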